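(* Let $f:\mathbb{R}^d\to\mathbb{R}$ be convex and $G$-Lipschitz continuous (not necessarily differentiable), let $h:\mathbb{R}^d\to\mathbb{R}\cup\{+\infty\}$ be convex, proper and lower semicontinuous, and suppose $F=f+h$ attains its minimum $F^*=F(x^* )$ at some $x^*\in\mathbb{R}^d$. Let $\gamma,\eta>0$ be arbitrary, let $x_1\in\mathrm{dom}(h)$, and let $\{x_k\}_{k\ge1}$ be generated by $$x_{k+1}=\operatorname*{arg\,min}_{x\in\mathbb{R}^d}\Big\{\langle\nabla f(x_k),x\rangle+\frac{S_k}{2\eta}\|x-x_k\|^2+h(x)\Big\},\qquad S_1=\gamma,\quad S_{k+1}^2=S_k^2\Big(1+\frac{\|x_{k+1}-x_k\|^2}{\eta^2}\Big),\quad k\ge1.$$ Suppose there is $D>0$ such that $\|x_{k+1}-x_k\|\le D$ and $\|x_k-x^*\|\le D$ for all $k\ge1$. Let $\bar x_t:=\frac1t\sum_{k=1}^tx_{k+1}$. Then there is a constant $c>0$ depending only on $G,\gamma,\eta,D$ and $F(x_1)-F^*$ such that for every $t\ge2$, $$F(\bar x_t)-F^*\le c\,\frac{\sqrt{\log t}}{\sqrt t}.$$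
   Context: $\|\cdot\|$ is the Euclidean norm and $\log$ the natural logarithm. $f$ is $G$-Lipschitz continuous if $|f(y)-f(x)|\le G\|y-x\|$ for all $x,y$. $\nabla f(x)\in\partial f(x)$ denotes a subgradient of $f$ at $x$ when $f$ is not differentiable. $\mathrm{dom}(h):=\{x:h(x)<+\infty\}$. $S_k>0$. *)

theory Defs
  imports "HOL-Analysis.Analysis"
begin

section \<open>Euclidean spaces of arbitrary dimension inside one type\<close>

text \<open>
  A constant that does not depend on the dimension has to be chosen before the dimension is, so
  the dimension cannot be a type. All spaces R^d are therefore placed in a single inner product
  space, that of the finitely supported real sequences with the inner product
  \<open>\<Sum>i. x i * y i\<close>; \<open>Rd d\<close> is the subspace spanned by the first \<open>d\<close> coordinates.
  (The norm which \<open>HOL-Analysis\<close> puts on the finitely supported functions of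
  \<open>Poly_Mapping\<close> is the l1 norm, hence the separate type.)
\<close>

typedef rvec = "{x :: nat \<Rightarrow> real. finite {i. x i \<noteq> 0}}"
  morphisms coord Abs_rvec
  by (rule exI[of _ "\<lambda>_. 0"]) simp

setup_lifting type_definition_rvec

lemma finite_coord [simp]: "finite {i. coord x i \<noteq> 0}"
  using coord[of x] by simp

lemma rvec_eqI: "(\<And>i. coord x i = coord y i) \<Longrightarrow> x = y"
  using coord_inject by blast

instantiation rvec :: real_vector
begin

lift_definition zero_rvec :: rvec is "\<lambda>_. 0"
  by simp

lift_definition plus_rvec :: "rvec \<Rightarrow> rvec \<Rightarrow> rvec" is "\<lambda>x y i. x i + y i"
proof -
  fix x y :: "nat \<Rightarrow> real"
  assume "finite {i. x i \<noteq> 0}" "finite {i. y i \<noteq> 0}"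
  then have "finite ({i. x i \<noteq> 0} \<union> {i. y i \<noteq> 0})" by simp
  then show "finite {i. x i + y i \<noteq> 0}" by (rule rev_finite_subset) auto
qed

lift_definition minus_rvec :: "rvec \<Rightarrow> rvec \<Rightarrow> rvec" is "\<lambda>x y i. x i - y i"
proof -
  fix x y :: "nat \<Rightarrow> real"
  assume "finite {i. x i \<noteq> 0}" "finite {i. y i \<noteq> 0}"
  then have "finite ({i. x i \<noteq> 0} \<union> {i. y i \<noteq> 0})" by simp
  then show "finite {i. x i - y i \<noteq> 0}" by (rule rev_finite_subset) auto
qed

lift_definition uminus_rvec :: "rvec \<Rightarrow> rvec" is "\<lambda>x i. - x i"
  by simp

lift_definition scaleR_rvec :: "real \<Rightarrow> rvec \<Rightarrow> rvec" is "\<lambda>r x i. r * x i"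
  by (erule rev_finite_subset) auto

instance
  by standard (transfer; simp add: fun_eq_iff algebra_simps)+

end

lemma coord_simps [simp]:
  "coord 0 i = 0"
  "coord (x + y) i = coord x i + coord y i"
  "coord (x - y) i = coord x i - coord y i"
  "coord (- x) i = - coord x i"
  "coord (r *\<^sub>R x) i = r * coord x i"
  by (transfer, simp)+

instantiation rvec :: real_inner
begin

definition inner_rvec :: "rvec \<Rightarrow> rvec \<Rightarrow> real" where
  "inner x y = (\<Sum>i | coord x i \<noteq> 0. coord x i * coord y i)"

definition norm_rvec :: "rvec \<Rightarrow> real" where
  "norm x = L2_set (coord x) {i. coord x i \<noteq> 0}"

definition sgn_rvec :: "rvec \<Rightarrow> rvec" where
  "sgn (x :: rvec) = inverse (norm x) *\<^sub>R x"

definition dist_rvec :: "rvec \<Rightarrow> rvec \<Rightarrow> real" where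
  "dist (x :: rvec) y = norm (x - y)"

definition uniformity_rvec :: "(rvec \<times> rvec) filter" where
  "uniformity_rvec = (INF e\<in>{0<..}. principal {(x, y). dist (x :: rvec) y < e})"

definition open_rvec :: "rvec set \<Rightarrow> bool" where
  "open_rvec U \<longleftrightarrow> (\<forall>x\<in>U. \<forall>\<^sub>F (x', y) in uniformity. x' = x \<longrightarrow> y \<in> U)"

lemma inner_rvec_superset:
  assumes "finite A" "{i. coord x i \<noteq> 0} \<subseteq> A"
  shows "inner x y = (\<Sum>i\<in>A. coord x i * coord y i)"
  unfolding inner_rvec_def by (rule sum.mono_neutral_left) (use assms in auto)

instance
proof
  fix x y z :: rvec and r :: real
  define A where "A = {i. coord x i \<noteq> 0} \<union> {i. coord y i \<noteq> 0}"
  have A: "finite A" "{i. coord x i \<noteq> 0} \<subseteq> A" "{i. coord y i \<noteq> 0} \<subseteq> A"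
    "{i. coord (x + y) i \<noteq> 0} \<subseteq> A" "{i. coord (r *\<^sub>R x) i \<noteq> 0} \<subseteq> A"
    by (auto simp: A_def)
  show "inner x y = inner y x"
    using A by (simp add: inner_rvec_superset[of A] mult.commute)
  show "inner (x + y) z = inner x z + inner y z"
    using A by (simp add: inner_rvec_superset[of A] algebra_simps sum.distrib)
  show "inner (r *\<^sub>R x) y = r * inner x y"
    unfolding inner_rvec_superset[OF A(1,5)] inner_rvec_superset[OF A(1,2)]
    by (simp add: sum_distrib_left algebra_simps)
  show "0 \<le> inner x x"
    by (simp add: inner_rvec_def sum_nonneg)
  show "inner x x = 0 \<longleftrightarrow> x = 0"
  proof
    assume "inner x x = 0"
    then have "\<forall>i\<in>{i. coord x i \<noteq> 0}. coord x i * coord x i = 0"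
      unfolding inner_rvec_def by (subst (asm) sum_nonneg_eq_0_iff) auto
    then show "x = 0" by (intro rvec_eqI) auto
  qed (simp add: inner_rvec_def)
  show "norm x = sqrt (inner x x)" 
    by (simp add: norm_rvec_def inner_rvec_def L2_set_def power2_eq_square)
  show "sgn x = x /\<^sub>R norm x" by (rule sgn_rvec_def)
  show "dist x y = norm (x - y)" by (rule dist_rvec_def)
  show "(uniformity :: (rvec \<times> rvec) filter) = (INF e\<in>{0<..}. principal {(x, y). dist (x :: rvec) y < e})"
    by (rule uniformity_rvec_def)
  show "open U \<longleftrightarrow> (\<forall>x\<in>U. \<forall>\<^sub>F (x', y) in uniformity. x' = x \<longrightarrow> y \<in> U)" for U :: "rvec set"
    by (rule open_rvec_def)
qed

end

definition Rd :: "nat \<Rightarrow> rvec set" where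
  "Rd d = {x. \<forall>i\<ge>d. coord x i = 0}"

lemma subspace_Rd: "subspace (Rd d)"
  by (auto simp: subspace_def Rd_def)

text \<open>\<open>Rd d\<close> is R^d: every d-tuple of coordinates occurs exactly once, and the inner product and
  the norm are the standard ones.\<close>

lemma bij_betw_coord_Rd: "bij_betw coord (Rd d) (topspace (Euclidean_space d))"
proof -
  have "x \<in> coord ` Rd d" if "\<forall>i\<ge>d. x i = 0" for x
  proof -
    have "{i. x i \<noteq> 0} \<subseteq> {..<d}"
      using that by (auto simp: not_le[symmetric])
    then have "coord (Abs_rvec x) = x"
      by (simp add: Abs_rvec_inverse finite_subset)
    then show ?thesis
      using that by (auto simp: Rd_def intro!: image_eqI[of _ _ "Abs_rvec x"])
  qed
  then show ?thesis
    by (auto simp: bij_betw_def inj_on_def coord_inject topspace_Euclidean_space Rd_def)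
qed

lemma inner_Rd: "x \<in> Rd d \<Longrightarrow> inner x y = (\<Sum>i<d. coord x i * coord y i)"
  by (rule inner_rvec_superset) (auto simp: Rd_def not_le[symmetric])

lemma norm_Rd: "x \<in> Rd d \<Longrightarrow> norm x = L2_set (coord x) {..<d}"
  by (simp add: norm_eq_sqrt_inner inner_Rd L2_set_def power2_eq_square)


section \<open>Convex analysis\<close>

text \<open>The four notions for extended-real functions \<open>h\<close> are relative to the space \<open>X\<close> on which \<open>h\<close>
  is considered.\<close>

definition edom :: "'a set \<Rightarrow> ('a \<Rightarrow> ereal) \<Rightarrow> 'a set" where
  "edom X h = {x \<in> X. h x < \<infinity>}"

definition proper_on :: "'a set \<Rightarrow> ('a \<Rightarrow> ereal) \<Rightarrow> bool" where
  "proper_on X h \<longleftrightarrow> (\<forall>x\<in>X. h x \<noteq> -\<infinity>) \<and> edom X h \<noteq> {}"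

text \<open>In \<open>ereal\<close>, \<open>0 * \<infinity> = 0\<close>, so the inequality is also the intended one for \<open>u = 0\<close> or \<open>v = 0\<close>.\<close>

definition econvex_on :: "'a::real_vector set \<Rightarrow> ('a \<Rightarrow> ereal) \<Rightarrow> bool" where
  "econvex_on X h \<longleftrightarrow> convex X \<and>
    (\<forall>x\<in>X. \<forall>y\<in>X. \<forall>u\<ge>0. \<forall>v\<ge>0. u + v = 1 \<longrightarrow>
      h (u *\<^sub>R x + v *\<^sub>R y) \<le> ereal u * h x + ereal v * h y)"

definition lsc_on :: "'a::topological_space set \<Rightarrow> ('a \<Rightarrow> ereal) \<Rightarrow> bool" where
  "lsc_on X h \<longleftrightarrow> (\<forall>x\<in>X. h x \<le> Liminf (at x within X) h)"

definition subdifferential :: "'a::real_inner set \<Rightarrow> ('a \<Rightarrow> real) \<Rightarrow> 'a \<Rightarrow> 'a set" where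
  "subdifferential X f x = {g \<in> X. \<forall>y\<in>X. f x + inner g (y - x) \<le> f y}"

definition composite :: "('a \<Rightarrow> real) \<Rightarrow> ('a \<Rightarrow> ereal) \<Rightarrow> 'a \<Rightarrow> ereal" where
  "composite f h x = ereal (f x) + h x"

end

theory Submission
  imports Defs
begin

text \<open>
  Strong convexity of the subproblem, compared at the minimizer and at the previous iterate, gives
  with \<open>\<Delta>\<^sub>k = F(x\<^sub>k) - F*\<close>, \<open>a\<^sub>k = \<parallel>x\<^sub>k - x*\<parallel>\<^sup>2\<close> and \<open>d\<^sub>k = \<parallel>x\<^sub>k\<^sub>+\<^sub>1 - x\<^sub>k\<parallel>\<close> the inequalities
  \<open>\<Delta>\<^sub>k\<^sub>+\<^sub>1 \<le> 2 G d\<^sub>k + S\<^sub>k (a\<^sub>k - a\<^sub>k\<^sub>+\<^sub>1) / (2 \<eta>)\<close> and \<open>\<Delta>\<^sub>k\<^sub>+\<^sub>1 + S\<^sub>k d\<^sub>k\<^sup>2 / \<eta> \<le> \<Delta>\<^sub>k + 2 G d\<^sub>k\<close>.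
  Since \<open>S\<^sub>k\<^sub>+\<^sub>1 - S\<^sub>k \<le> S\<^sub>k d\<^sub>k\<^sup>2 / (2 \<eta>\<^sup>2)\<close>, summing the second one bounds \<open>S\<^sub>t\<close> by a multiple of
  \<open>1 + \<Sum> d\<^sub>k\<close>, a priori linearly in \<open>t\<close> because \<open>d\<^sub>k \<le> D\<close>. Taking logarithms in the product formula for
  \<open>S\<^sub>t\<^sup>2\<close> then yields \<open>\<Sum> d\<^sub>k\<^sup>2 = O(log t)\<close>, hence by Cauchy-Schwarz \<open>\<Sum> d\<^sub>k\<close> and in turn \<open>S\<^sub>t\<close> are
  \<open>O(sqrt (t log t))\<close>. Summing the first inequality by parts and applying Jensen gives the rate.
\<close>

section \<open>One proximal subgradient step\<close>

text \<open>The squared norm satisfies the convexity inequality with an exact quadratic remainder.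
  Comparing \<open>p\<close> with points of the segment from \<open>p\<close> to \<open>y\<close>
  turns this remainder into the gain \<open>a * (norm (y - p))\<^sup>2\<close>.\<close>

lemma proximal_three_point:
  fixes H :: "'a::real_inner \<Rightarrow> real"
  assumes H: "convex_on E H" and p: "p \<in> E" and y: "y \<in> E"
    and min: "\<And>z. z \<in> E \<Longrightarrow> inner g p + a * (norm (p - x))\<^sup>2 + H p \<le> inner g z + a * (norm (z - x))\<^sup>2 + H z"
  shows "inner g p + a * (norm (p - x))\<^sup>2 + H p + a * (norm (y - p))\<^sup>2
    \<le> inner g y + a * (norm (y - x))\<^sup>2 + H y"
proof -
  define q where "q z = inner g z + a * (norm (z - x))\<^sup>2 + H z" for z
  have "s * (a * (norm (y - p))\<^sup>2) \<le> q y - q p" if s: "0 < s" "s < 1" for s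
  proof -
    define z where "z = s *\<^sub>R p + (1 - s) *\<^sub>R y"
    have z: "z \<in> E"
      unfolding z_def using convex_on_imp_convex[OF H] p y s by (auto intro: convexD)
    have Hz: "H z \<le> s * H p + (1 - s) * H y"
      unfolding z_def using H p y s by (auto simp: convex_on_def)
    have n: "(norm (z - x))\<^sup>2 = s * (norm (p - x))\<^sup>2 + (1 - s) * (norm (y - x))\<^sup>2
        - s * (1 - s) * (norm (y - p))\<^sup>2"
      unfolding z_def power2_norm_eq_inner
      by (simp add: inner_commute algebra_simps)
    have "q p \<le> q z"
      using min[OF z] by (simp add: q_def)
    also have "\<dots> \<le> s * q p + (1 - s) * q y - s * (1 - s) * (a * (norm (y - p))\<^sup>2)"
      unfolding q_def n using Hz by (simp add: z_def algebra_simps)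
    finally have "(1 - s) * (s * (a * (norm (y - p))\<^sup>2)) \<le> (1 - s) * (q y - q p)"
      by (simp add: algebra_simps)
    then show ?thesis using s by simp
  qed
  \<comment> \<open>The factor \<open>1 - s\<close> has been cancelled; letting \<open>s\<close>
    tend to 1 moves the comparison point to \<open>p\<close> and recovers the full gain.\<close>
  then have "a * (norm (y - p))\<^sup>2 \<le> q y - q p"
    by (rule field_le_mult_one_interval)
  then show ?thesis by (simp add: q_def)
qed

text \<open>Testing the subgradient inequality at \<open>x + g\<close>, which stays in the subspace,
  bounds the square of \<open>norm g\<close> by \<open>G * norm g\<close>.\<close>

lemma norm_subgradient_le:
  assumes X: "subspace X" and f: "G-lipschitz_on X f" and x: "x \<in> X" and g: "g \<in> subdifferential X f x"
  shows "norm g \<le> G"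
proof (cases "g = 0")
  case True
  then show ?thesis using lipschitz_on_nonneg[OF f] by simp
next
  case False
  have gX: "g \<in> X" and sub: "\<And>y. y \<in> X \<Longrightarrow> f x + inner g (y - x) \<le> f y"
    using g by (auto simp: subdifferential_def)
  have "f x + inner g g \<le> f (x + g)"
    using sub[OF subspace_add[OF X x gX]] by simp
  then have "norm g * norm g \<le> dist (f (x + g)) (f x)"
    by (simp add: dist_real_def flip: power2_norm_eq_inner power2_eq_square)
  also have "\<dots> \<le> G * dist (x + g) x"
    using lipschitz_onD[OF f] x gX X by (auto intro: subspace_add)
  finally show ?thesis using False by (simp add: dist_norm)
qed

text \<open>The factor 2 in \<open>2 * G\<close> has two sources: one \<open>G\<close> pays for
  replacing \<open>f x\<close> by \<open>f p\<close>, the other for the linear term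
  \<open>inner g (p - x)\<close>.\<close>

lemma proximal_subgradient_step:
  fixes f H :: "'a::real_inner \<Rightarrow> real"
  assumes X: "subspace X" and f: "G-lipschitz_on X f" and H: "convex_on E H" and "E \<subseteq> X"
    and x: "x \<in> X" and p: "p \<in> E" and y: "y \<in> E" and g: "g \<in> subdifferential X f x"
    and min: "\<And>z. z \<in> E \<Longrightarrow> inner g p + a * (norm (p - x))\<^sup>2 + H p \<le> inner g z + a * (norm (z - x))\<^sup>2 + H z"
  shows "f p + H p + a * (norm (y - p))\<^sup>2 + a * (norm (p - x))\<^sup>2
    \<le> f y + H y + 2 * G * norm (p - x) + a * (norm (y - x))\<^sup>2"
proof -
  have "dist (f p) (f x) \<le> G * dist p x"
    using lipschitz_onD[OF f] p x \<open>E \<subseteq> X\<close> by blast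
  then have "f p \<le> f x + G * norm (p - x)"
    by (simp add: dist_real_def dist_norm)
  moreover have "f x + inner g (y - x) \<le> f y"
    using g y \<open>E \<subseteq> X\<close> by (auto simp: subdifferential_def)
  moreover have "- inner g (p - x) \<le> G * norm (p - x)"
  proof -
    have "- inner g (p - x) \<le> norm g * norm (p - x)"
      using Cauchy_Schwarz_ineq2[of g "p - x"] by linarith
    also have "\<dots> \<le> G * norm (p - x)"
      by (rule mult_right_mono[OF norm_subgradient_le[OF X f x g]]) simp
    finally show ?thesis .
  qed
  ultimately show ?thesis
    using proximal_three_point[OF H p y min] by (simp add: inner_diff_right)
qed

section \<open>Summation inequalities\<close>

lemma telescope_weighted_le:
  fixes w a :: "nat \<Rightarrow> real"
  assumes mono: "\<And>k. k \<ge> 1 \<Longrightarrow> w k \<le> w (Suc k)" and "0 \<le> w 1"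
    and a: "\<And>k. k \<ge> 1 \<Longrightarrow> 0 \<le> a k \<and> a k \<le> A" and "t \<ge> 1"
  shows "(\<Sum>k=1..t. w k * (a k - a (Suc k))) \<le> w t * A"
proof -
  \<comment> \<open>The boundary term of the summation by parts is kept so that the induction
    closes; it is dropped afterwards by its sign.\<close>
  have "(\<Sum>k=1..t. w k * (a k - a (Suc k))) \<le> w t * A - w t * a (Suc t)"
    using \<open>t \<ge> 1\<close>
  proof (induction t rule: nat_induct_at_least)
    case base
    then show ?case using a[of 1] mult_left_mono[of "a 1" A "w 1"] \<open>0 \<le> w 1\<close> by (simp add: algebra_simps)
  next
    case (Suc t)
    have "(w (Suc t) - w t) * a (Suc t) \<le> (w (Suc t) - w t) * A"
      using mono[OF Suc.hyps] a[of "Suc t"] by (intro mult_left_mono) auto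
    then show ?case using Suc.IH Suc.hyps by (simp add: algebra_simps)
  qed
  moreover have "0 \<le> w t"
    using \<open>t \<ge> 1\<close> by (induction t rule: nat_induct_at_least) (use \<open>0 \<le> w 1\<close> mono in \<open>auto intro: order_trans\<close>)
  then have "0 \<le> w t * a (Suc t)"
    using a[of "Suc t"] by simp
  ultimately show ?thesis by linarith
qed

lemma sum_le_sqrt_sum_squares:
  fixes d :: "'a \<Rightarrow> real"
  shows "(\<Sum>k\<in>A. d k) \<le> sqrt (card A * (\<Sum>k\<in>A. (d k)\<^sup>2))"
proof -
  have "(\<Sum>k\<in>A. d k) \<le> (\<Sum>k\<in>A. \<bar>1\<bar> * \<bar>d k\<bar>)"
    by (intro sum_mono) simp
  also have "\<dots> \<le> L2_set (\<lambda>_. 1) A * L2_set d A"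
    by (rule L2_set_mult_ineq)
  also have "\<dots> = sqrt (card A * (\<Sum>k\<in>A. (d k)\<^sup>2))"
    by (simp add: L2_set_def real_sqrt_mult)
  finally show ?thesis .
qed

section \<open>Scalar recursions and their constants\<close>

text \<open>Coefficient of the a priori linear bound on \<open>S (Suc t) / \<gamma>\<close>.\<close>

definition growth_const :: "real \<Rightarrow> real \<Rightarrow> real \<Rightarrow> real \<Rightarrow> real \<Rightarrow> real" where
  "growth_const G \<gamma> \<eta> D \<delta> = 1 + (\<delta> + 2 * G * D) / (2 * \<eta> * \<gamma>)"

text \<open>Coefficient of \<open>ln t\<close> in the bound on the sum of squared steps. The
  quotient by \<open>ln 2\<close> absorbs an additive constant, since \<open>ln t\<close> is at
  least \<open>ln 2\<close> for \<open>t \<ge> 2\<close>.\<close>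

definition step_const :: "real \<Rightarrow> real \<Rightarrow> real \<Rightarrow> real \<Rightarrow> real \<Rightarrow> real" where
  "step_const G \<gamma> \<eta> D \<delta> = 2 * (\<eta>\<^sup>2 + D\<^sup>2) * (1 + ln (growth_const G \<gamma> \<eta> D \<delta>) / ln 2)"

definition rate_const :: "real \<Rightarrow> real \<Rightarrow> real \<Rightarrow> real \<Rightarrow> real \<Rightarrow> real" where
  "rate_const G \<gamma> \<eta> D \<delta> = D\<^sup>2 / (2 * \<eta>) * (\<gamma> + \<delta> / (2 * \<eta>))
    + (G * D\<^sup>2 / (2 * \<eta>\<^sup>2) + 2 * G) * sqrt (step_const G \<gamma> \<eta> D \<delta>)"

text \<open>\<open>\<Delta>\<close>, \<open>a\<close> and \<open>d\<close> stand for the optimality gaps, the squared distances to the minimizer and the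
  step lengths.\<close>

locale adaptive_steps =
  fixes \<Delta> a d S :: "nat \<Rightarrow> real" and G \<gamma> \<eta> D :: real
  assumes pos: "0 \<le> G" "0 < \<gamma>" "0 < \<eta>" "0 < D"
    and gap: "k \<ge> 1 \<Longrightarrow> \<Delta> (Suc k) + S k / (2 * \<eta>) * a (Suc k) + S k / (2 * \<eta>) * (d k)\<^sup>2
        \<le> 2 * G * d k + S k / (2 * \<eta>) * a k"
    and descent: "k \<ge> 1 \<Longrightarrow> \<Delta> (Suc k) + S k / \<eta> * (d k)\<^sup>2 \<le> \<Delta> k + 2 * G * d k"
    and gap_nonneg: "k \<ge> 1 \<Longrightarrow> 0 \<le> \<Delta> k"
    and a: "k \<ge> 1 \<Longrightarrow> 0 \<le> a k \<and> a k \<le> D\<^sup>2"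
    and d: "k \<ge> 1 \<Longrightarrow> 0 \<le> d k \<and> d k \<le> D"
    and S_pos: "k \<ge> 1 \<Longrightarrow> 0 < S k" and S_1: "S 1 = \<gamma>"
    and S_rec: "k \<ge> 1 \<Longrightarrow> (S (Suc k))\<^sup>2 = (S k)\<^sup>2 * (1 + (d k)\<^sup>2 / \<eta>\<^sup>2)"
begin

lemma S_mono: "k \<ge> 1 \<Longrightarrow> S k \<le> S (Suc k)"
  by (rule power2_le_imp_le) (use S_rec[of k] S_pos[of "Suc k"] in \<open>auto simp: algebra_simps\<close>)

text \<open>This is sqrt(1 + u) \<le> 1 + u/2 in squared form. It makes the growth of
  \<open>S\<close> comparable with the quadratic term of \<open>descent\<close>.\<close>

lemma S_increment:
  assumes "k \<ge> 1"
  shows "S (Suc k) \<le> S k + S k * (d k)\<^sup>2 / (2 * \<eta>\<^sup>2)"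
proof (rule power2_le_imp_le)
  let ?u = "(d k)\<^sup>2 / \<eta>\<^sup>2"
  have "1 + ?u \<le> (1 + ?u / 2)\<^sup>2"
    unfolding power2_sum by simp
  then have "(S (Suc k))\<^sup>2 \<le> (S k)\<^sup>2 * (1 + ?u / 2)\<^sup>2"
    unfolding S_rec[OF assms] by (intro mult_left_mono) auto
  then show "(S (Suc k))\<^sup>2 \<le> (S k + S k * (d k)\<^sup>2 / (2 * \<eta>\<^sup>2))\<^sup>2"
    by (simp add: algebra_simps flip: power_mult_distrib)
qed (use S_pos[OF assms] in simp)

text \<open>Each increment of \<open>S\<close> is at most \<open>1 / (2 * \<eta>)\<close> times the
  quadratic term of \<open>descent\<close>, so the gaps telescope. The induction carries the last
  gap along, and nonnegativity then removes it.\<close>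

lemma S_le_sum_steps:
  "S (Suc t) \<le> \<gamma> + (\<Delta> 1 + 2 * G * (\<Sum>k=1..t. d k)) / (2 * \<eta>)"
proof -
  have "S (Suc t) \<le> \<gamma> + (\<Delta> 1 - \<Delta> (Suc t) + 2 * G * (\<Sum>k=1..t. d k)) / (2 * \<eta>)"
  proof (induction t)
    case 0
    then show ?case using S_1 by simp
  next
    case (Suc t)
    have "S (Suc t) / \<eta> * (d (Suc t))\<^sup>2 / (2 * \<eta>)
        \<le> (\<Delta> (Suc t) - \<Delta> (Suc (Suc t)) + 2 * G * d (Suc t)) / (2 * \<eta>)"
      using descent[of "Suc t"] pos by (intro divide_right_mono) auto
    then have "S (Suc t) * (d (Suc t))\<^sup>2 / (2 * \<eta>\<^sup>2)
        \<le> (\<Delta> (Suc t) - \<Delta> (Suc (Suc t)) + 2 * G * d (Suc t)) / (2 * \<eta>)"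
      by (simp add: power2_eq_square mult_ac)
    then show ?case using S_increment[of "Suc t"] Suc
      by (simp add: algebra_simps add_divide_distrib diff_divide_distrib)
  qed
  also have "\<dots> \<le> \<gamma> + (\<Delta> 1 + 2 * G * (\<Sum>k=1..t. d k)) / (2 * \<eta>)"
    using gap_nonneg[of "Suc t"] pos by (intro add_left_mono divide_right_mono) auto
  finally show ?thesis .
qed

text \<open>With u = \<open>(d k)\<^sup>2 / \<eta>\<^sup>2\<close>, the bound
  \<open>d k \<le> D\<close> gives \<open>(d k)\<^sup>2 / (\<eta>\<^sup>2 + D\<^sup>2)\<close> \<le>
  u / (1 + u) \<le> ln (1 + u), and ln (1 + u) is twice the increment of \<open>ln (S k)\<close>,
  which telescopes.\<close>

lemma sum_squares_le_ln: "(\<Sum>k=1..t. (d k)\<^sup>2) \<le> 2 * (\<eta>\<^sup>2 + D\<^sup>2) * ln (S (Suc t) / \<gamma>)"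
proof (induction t)
  case 0
  then show ?case using S_1 pos by simp
next
  case (Suc t)
  let ?u = "(d (Suc t))\<^sup>2 / \<eta>\<^sup>2" and ?C = "\<eta>\<^sup>2 + D\<^sup>2"
  have dD: "(d (Suc t))\<^sup>2 \<le> D\<^sup>2"
    using d[of "Suc t"] by (intro power_mono) auto
  have pos': "0 < S (Suc t)" "0 < S (Suc (Suc t))"
    by (auto intro: S_pos)
  have "(d (Suc t))\<^sup>2 / ?C \<le> (d (Suc t))\<^sup>2 / (\<eta>\<^sup>2 + (d (Suc t))\<^sup>2)"
    using dD pos by (intro divide_left_mono) (auto intro!: mult_pos_pos add_pos_nonneg)
  also have "\<dots> = 1 - inverse (1 + ?u)"
    using pos by (simp add: field_simps add_pos_nonneg)
  also have "\<dots> \<le> ln (1 + ?u)"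
    using ln_le_minus_one[of "inverse (1 + ?u)"] by (simp add: ln_inverse add_pos_nonneg)
  also have "1 + ?u = (S (Suc (Suc t)) / S (Suc t))\<^sup>2"
    using S_rec[of "Suc t"] pos' by (simp add: power_divide)
  also have "ln \<dots> = 2 * (ln (S (Suc (Suc t)) / \<gamma>) - ln (S (Suc t) / \<gamma>))"
    using pos' pos by (simp add: ln_realpow ln_div)
  finally have "(d (Suc t))\<^sup>2 \<le> 2 * (ln (S (Suc (Suc t)) / \<gamma>) - ln (S (Suc t) / \<gamma>)) * ?C"
    using pos by (simp add: pos_divide_le_eq add_pos_nonneg)
  then show ?case using Suc by (simp add: algebra_simps)
qed

abbreviation "B \<equiv> growth_const G \<gamma> \<eta> D (\<Delta> 1)"

abbreviation "L \<equiv> step_const G \<gamma> \<eta> D (\<Delta> 1)"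

lemma B_ge_1: "1 \<le> B"
  using pos gap_nonneg[of 1] by (simp add: growth_const_def)

lemma sum_squares_le:
  assumes "t \<ge> 2"
  shows "(\<Sum>k=1..t. (d k)\<^sup>2) \<le> L * ln t"
proof -
  \<comment> \<open>The crude bound by \<open>t * D\<close> suffices here: the resulting linear
    growth of \<open>S\<close> enters only through its logarithm.\<close>
  have "(\<Sum>k=1..t. d k) \<le> real (card {1..t}) * D"
    using d by (intro sum_bounded_above) auto
  then have "2 * G * (\<Sum>k=1..t. d k) \<le> 2 * G * (t * D)"
    using pos by (intro mult_left_mono) auto
  moreover have "\<Delta> 1 \<le> t * \<Delta> 1"
    using gap_nonneg[of 1] assms mult_right_mono[of 1 "real t" "\<Delta> 1"] by simp
  ultimately have "(\<Delta> 1 + 2 * G * (\<Sum>k=1..t. d k)) / (2 * \<eta>) \<le> t * (\<Delta> 1 + 2 * G * D) / (2 * \<eta>)"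
    using pos by (intro divide_right_mono) (auto simp: algebra_simps)
  moreover have "\<gamma> \<le> t * \<gamma>"
    using pos assms by simp
  ultimately have "S (Suc t) \<le> t * \<gamma> + t * (\<Delta> 1 + 2 * G * D) / (2 * \<eta>)"
    using S_le_sum_steps[of t] by linarith
  also have "\<dots> = t * B * \<gamma>"
    using pos by (simp add: growth_const_def field_simps)
  finally have "S (Suc t) / \<gamma> \<le> t * B"
    using pos by (simp add: pos_divide_le_eq)
  then have "ln (S (Suc t) / \<gamma>) \<le> ln (t * B)"
    using S_pos[of "Suc t"] pos B_ge_1 assms by (subst ln_le_cancel_iff) auto
  also have "\<dots> = ln t + ln B / ln 2 * ln 2"
    using B_ge_1 assms by (simp add: ln_mult)
  also have "\<dots> \<le> ln t + ln B / ln 2 * ln t"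
    using B_ge_1 assms by (intro add_left_mono mult_left_mono) auto
  finally have "2 * (\<eta>\<^sup>2 + D\<^sup>2) * ln (S (Suc t) / \<gamma>) \<le> 2 * (\<eta>\<^sup>2 + D\<^sup>2) * (ln t + ln B / ln 2 * ln t)"
    by (intro mult_left_mono) auto
  then show ?thesis
    using sum_squares_le_ln[of t] by (simp add: step_const_def algebra_simps)
qed

lemma sum_gap_le:
  assumes "t \<ge> 2"
  shows "(\<Sum>k=1..t. \<Delta> (Suc k)) \<le> rate_const G \<gamma> \<eta> D (\<Delta> 1) * sqrt (t * ln t)"
proof -
  define T where "T = (\<Sum>k=1..t. d k)"
  define C0 where "C0 = D\<^sup>2 / (2 * \<eta>) * (\<gamma> + \<Delta> 1 / (2 * \<eta>))"
  define C1 where "C1 = G * D\<^sup>2 / (2 * \<eta>\<^sup>2) + 2 * G"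
  have nonneg: "0 \<le> C0" "0 \<le> C1"
    using pos gap_nonneg[of 1] by (auto simp: C0_def C1_def)
  have "T \<le> sqrt (t * (\<Sum>k=1..t. (d k)\<^sup>2))"
    unfolding T_def using sum_le_sqrt_sum_squares[of d "{1..t}"] by simp
  also have "\<dots> \<le> sqrt (t * (L * ln t))"
    using sum_squares_le[OF assms] by (intro real_sqrt_le_mono mult_left_mono) auto
  finally have T: "T \<le> sqrt L * sqrt (t * ln t)"
    by (simp add: real_sqrt_mult mult_ac)
  \<comment> \<open>As \<open>t * ln t\<close> is at least 4/3, the constant term \<open>C0\<close>
    can be absorbed into the rate.\<close>
  have "2 / 3 \<le> ln (real t)"
    using ln2_ge_two_thirds assms order_trans[of "2/3" "ln 2" "ln (real t)"] by simp
  then have "2 * (2 / 3) \<le> t * ln (real t)"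
    using assms by (intro mult_mono) auto
  then have one: "1 \<le> sqrt (t * ln t)" by simp
  have "\<Delta> (Suc k) \<le> S k / (2 * \<eta>) * (a k - a (Suc k)) + 2 * G * d k" if "k \<in> {1..t}" for k
  proof -
    have "0 \<le> S k / (2 * \<eta>) * (d k)\<^sup>2"
      using S_pos[of k] that pos by auto
    then show ?thesis
      using gap[of k] that by (simp add: right_diff_distrib)
  qed
  then have "(\<Sum>k=1..t. \<Delta> (Suc k)) \<le> (\<Sum>k=1..t. S k / (2 * \<eta>) * (a k - a (Suc k)) + 2 * G * d k)"
    by (rule sum_mono)
  also have "\<dots> = (\<Sum>k=1..t. S k / (2 * \<eta>) * (a k - a (Suc k))) + 2 * G * T"
    by (simp only: sum.distrib T_def sum_distrib_left)
  also have "(\<Sum>k=1..t. S k / (2 * \<eta>) * (a k - a (Suc k))) \<le> S t / (2 * \<eta>) * D\<^sup>2"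
    using S_mono S_1 a pos assms by (intro telescope_weighted_le) (auto intro: divide_right_mono)
  \<comment> \<open>The available bound is for \<open>S (Suc t)\<close>; monotonicity passes it to
    the weight \<open>S t\<close> while \<open>T\<close> keeps all \<open>t\<close> steps.\<close>
  also have "\<dots> \<le> (\<gamma> + (\<Delta> 1 + 2 * G * T) / (2 * \<eta>)) / (2 * \<eta>) * D\<^sup>2"
    using S_le_sum_steps[of t] S_mono[of t] pos assms
    by (intro mult_right_mono divide_right_mono) (auto simp: T_def)
  also have "\<dots> + 2 * G * T = C0 * 1 + C1 * T"
    using pos by (simp add: C0_def C1_def field_simps power2_eq_square)
  also have "\<dots> \<le> C0 * sqrt (t * ln t) + C1 * (sqrt L * sqrt (t * ln t))"
    using T one nonneg by (intro add_mono mult_left_mono) auto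
  finally show ?thesis
    by (simp add: C0_def C1_def rate_const_def algebra_simps)
qed

end

section \<open>From extended-real objectives to the scalar recursions\<close>

lemma ereal_real_of_edom:
  "proper_on X h \<Longrightarrow> y \<in> edom X h \<Longrightarrow> ereal (real_of_ereal (h y)) = h y"
  by (auto simp: proper_on_def edom_def ereal_real less_le)

text \<open>A convex combination of finite values bounds \<open>h\<close> from above, so the
  effective domain is convex; properness excludes minus infinity, so passing to reals there loses
  nothing.\<close>

lemma convex_on_edom:
  assumes "econvex_on X h" and "proper_on X h"
  shows "convex_on (edom X h) (\<lambda>y. real_of_ereal (h y))"
proof -
  have *: "u *\<^sub>R y + v *\<^sub>R z \<in> edom X h \<and>
      real_of_ereal (h (u *\<^sub>R y + v *\<^sub>R z)) \<le> u * real_of_ereal (h y) + v * real_of_ereal (h z)"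
    if y: "y \<in> edom X h" and z: "z \<in> edom X h" and uv: "0 \<le> u" "0 \<le> v" "u + v = 1" for y z u v
  proof -
    let ?w = "u *\<^sub>R y + v *\<^sub>R z"
    have X: "convex X" "y \<in> X" "z \<in> X"
      using assms(1) y z by (auto simp: econvex_on_def edom_def)
    have "h ?w \<le> ereal u * h y + ereal v * h z"
      using assms(1) X uv by (auto simp: econvex_on_def)
    also have "\<dots> = ereal (u * real_of_ereal (h y) + v * real_of_ereal (h z))"
      using ereal_real_of_edom[OF assms(2) y] ereal_real_of_edom[OF assms(2) z]
      by (metis plus_ereal.simps(1) times_ereal.simps(1))
    finally have le: "h ?w \<le> \<dots>" .
    have w: "?w \<in> edom X h"
      using le X uv by (auto simp: edom_def convexD)
    then show ?thesis
      using le ereal_real_of_edom[OF assms(2) w] by (metis ereal_less_eq(3))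
  qed
  then have "convex (edom X h)"
    by (auto intro!: convexI)
  then show ?thesis
    using * by (auto simp: convex_on_def)
qed

lemma is_arg_min_le: "is_arg_min (q :: 'a \<Rightarrow> 'b::linorder) P p \<Longrightarrow> P y \<Longrightarrow> q p \<le> q y"
  by (auto simp: is_arg_min_linorder)

lemma adaptive_subgradient_rate:
  fixes X :: "'a::real_inner set" and f :: "'a \<Rightarrow> real" and x g :: "nat \<Rightarrow> 'a"
  assumes X: "subspace X" and fconv: "convex_on X f" and lip: "G-lipschitz_on X f"
    and h: "econvex_on X h" "proper_on X h"
    and xmin: "is_arg_min (composite f h) (\<lambda>y. y \<in> X) xmin"
    and pos: "0 < \<gamma>" "0 < \<eta>" "0 < D"
    and x1: "x 1 \<in> edom X h"
    and g: "\<And>k. k \<ge> 1 \<Longrightarrow> g k \<in> subdifferential X f (x k)"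
    and step: "\<And>k. k \<ge> 1 \<Longrightarrow> is_arg_min
         (\<lambda>y. ereal (inner (g k) y + S k / (2 * \<eta>) * (norm (y - x k))\<^sup>2) + h y) (\<lambda>y. y \<in> X) (x (Suc k))"
    and S_pos: "\<And>k. k \<ge> 1 \<Longrightarrow> 0 < S k" and S_1: "S 1 = \<gamma>"
    and S_rec: "\<And>k. k \<ge> 1 \<Longrightarrow> (S (Suc k))\<^sup>2 = (S k)\<^sup>2 * (1 + (norm (x (Suc k) - x k))\<^sup>2 / \<eta>\<^sup>2)"
    and d: "\<And>k. k \<ge> 1 \<Longrightarrow> norm (x (Suc k) - x k) \<le> D"
    and a: "\<And>k. k \<ge> 1 \<Longrightarrow> norm (x k - xmin) \<le> D"
    and t: "t \<ge> 2"
  shows "composite f h ((1 / real t) *\<^sub>R (\<Sum>k=1..t. x (Suc k))) - composite f h xmin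
    \<le> ereal (rate_const G \<gamma> \<eta> D (real_of_ereal (composite f h (x 1) - composite f h xmin))
              * (sqrt (ln (real t)) / sqrt (real t)))"
proof -
  define E where "E = edom X h"
  define H where "H y = real_of_ereal (h y)" for y
  define F where "F y = f y + H y" for y
  have hH: "h y = ereal (H y)" if "y \<in> E" for y
    using ereal_real_of_edom[OF h(2)] that by (simp add: E_def H_def)
  have FE: "composite f h y = ereal (F y)" if "y \<in> E" for y
    using hH[OF that] by (simp add: composite_def F_def)
  have EX: "E \<subseteq> X" by (auto simp: E_def edom_def)
  have H: "convex_on E H"
    unfolding E_def H_def using convex_on_edom[OF h] .
  have F: "convex_on E F"
    unfolding F_def
    by (intro convex_on_add H convex_on_subset[OF fconv] EX convex_on_imp_convex[OF H])
  have x1E: "x 1 \<in> E" using x1 by (simp add: E_def)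
  have finite_imp: "y \<in> E" if "ereal r + h y \<le> ereal s" "y \<in> X" for y r s
    using that by (cases "h y") (auto simp: E_def edom_def)
  have mE: "xmin \<in> E"
  proof (rule finite_imp)
    show "ereal (f xmin) + h xmin \<le> ereal (F (x 1))"
      using is_arg_min_le[OF xmin, of "x 1"] x1E EX FE[OF x1E] by (auto simp: composite_def)
    show "xmin \<in> X" using xmin by (simp add: is_arg_min_def)
  qed
  have min: "F xmin \<le> F y" if "y \<in> E" for y
    using is_arg_min_le[OF xmin, of y] that EX FE[OF mE] FE[OF that] by auto
  \<comment> \<open>Every later iterate minimizes an objective that is finite at \<open>x 1\<close>,
    so \<open>h\<close> is finite there; no induction over the iterates is involved.\<close>
  have xE: "x k \<in> E" if "k \<ge> 1" for k
    using that
  proof (cases k rule: nat.exhaust)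
    case (Suc j)
    show ?thesis
    proof (cases "j = 0")
      case False
      then have j: "j \<ge> 1" by simp
      let ?q = "\<lambda>y. inner (g j) y + S j / (2 * \<eta>) * (norm (y - x j))\<^sup>2"
      have "x (Suc j) \<in> E"
      proof (rule finite_imp)
        have "ereal (?q (x (Suc j))) + h (x (Suc j)) \<le> ereal (?q (x 1)) + h (x 1)"
          using is_arg_min_le[OF step[OF j]] x1E EX by blast
        also have "\<dots> = ereal (?q (x 1) + H (x 1))"
          by (simp only: hH[OF x1E] plus_ereal.simps)
        finally show "ereal (?q (x (Suc j))) + h (x (Suc j)) \<le> \<dots>" .
        show "x (Suc j) \<in> X"
          using step[OF j] by (simp add: is_arg_min_def)
      qed
      then show ?thesis by (simp add: Suc)
    qed (use Suc x1E in simp)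
  qed simp
  \<comment> \<open>The comparison point stays free: \<open>y = xmin\<close> yields
    \<open>gap\<close>, and \<open>y = x k\<close> yields \<open>descent\<close>, where the two
    quadratic terms merge into the coefficient \<open>S k / \<eta>\<close>.\<close>
  have key: "F (x (Suc k)) + S k / (2 * \<eta>) * (norm (y - x (Suc k)))\<^sup>2
        + S k / (2 * \<eta>) * (norm (x (Suc k) - x k))\<^sup>2
      \<le> F y + 2 * G * norm (x (Suc k) - x k) + S k / (2 * \<eta>) * (norm (y - x k))\<^sup>2"
    if k: "k \<ge> 1" and y: "y \<in> E" for k y
    unfolding F_def
  proof (rule proximal_subgradient_step[OF X lip H EX _ _ y g[OF k]])
    show "x k \<in> X" "x (Suc k) \<in> E"
      using xE[OF k] xE[of "Suc k"] EX by auto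
    fix z assume z: "z \<in> E"
    then show "inner (g k) (x (Suc k)) + S k / (2 * \<eta>) * (norm (x (Suc k) - x k))\<^sup>2 + H (x (Suc k))
        \<le> inner (g k) z + S k / (2 * \<eta>) * (norm (z - x k))\<^sup>2 + H z"
      using is_arg_min_le[OF step[OF k], of z] EX hH[OF z] hH[OF xE[of "Suc k"]] by auto
  qed
  interpret adaptive_steps "\<lambda>k. F (x k) - F xmin" "\<lambda>k. (norm (xmin - x k))\<^sup>2"
    "\<lambda>k. norm (x (Suc k) - x k)" S G \<gamma> \<eta> D
  proof
    fix k :: nat assume k: "k \<ge> 1"
    show "F (x (Suc k)) - F xmin + S k / (2 * \<eta>) * (norm (xmin - x (Suc k)))\<^sup>2
        + S k / (2 * \<eta>) * (norm (x (Suc k) - x k))\<^sup>2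
      \<le> 2 * G * norm (x (Suc k) - x k) + S k / (2 * \<eta>) * (norm (xmin - x k))\<^sup>2"
      using key[OF k mE] by simp
    show "F (x (Suc k)) - F xmin + S k / \<eta> * (norm (x (Suc k) - x k))\<^sup>2
        \<le> F (x k) - F xmin + 2 * G * norm (x (Suc k) - x k)"
      using key[OF k xE[OF k]] pos by (simp add: norm_minus_commute field_simps)
    show "0 \<le> F (x k) - F xmin" using min[OF xE[OF k]] by simp
    show "0 \<le> (norm (xmin - x k))\<^sup>2 \<and> (norm (xmin - x k))\<^sup>2 \<le> D\<^sup>2"
      using a[OF k] by (auto simp: norm_minus_commute intro: power_mono)
  qed (use pos lip S_pos S_1 S_rec d in \<open>auto intro: lipschitz_on_nonneg\<close>)
  let ?m = "(1 / real t) *\<^sub>R (\<Sum>k=1..t. x (Suc k))"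
  have m: "?m = (\<Sum>k\<in>{1..t}. (1 / real t) *\<^sub>R x (Suc k))"
    by (rule scaleR_sum_right)
  have mean: "?m \<in> E"
    unfolding m using xE t by (intro convex_sum convex_on_imp_convex[OF H]) auto
  \<comment> \<open>Jensen's inequality with equal weights on the convex set
    \<open>E\<close>.\<close>
  have "F ?m \<le> (\<Sum>k=1..t. 1 / real t * F (x (Suc k)))"
    unfolding m using xE t by (intro convex_on_sum[OF _ _ F]) auto
  then have "F ?m - F xmin \<le> (\<Sum>k=1..t. F (x (Suc k)) - F xmin) / t"
    using t by (simp add: sum_subtractf diff_divide_distrib flip: sum_divide_distrib)
  also have "\<dots> \<le> rate_const G \<gamma> \<eta> D (F (x 1) - F xmin) * sqrt (t * ln t) / t"
    by (intro divide_right_mono sum_gap_le t) simp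
  also have "\<dots> = rate_const G \<gamma> \<eta> D (F (x 1) - F xmin) * (sqrt (ln t) / sqrt t)"
    using t by (simp add: real_sqrt_mult field_simps)
  finally show ?thesis
    by (simp add: FE[OF mean] FE[OF mE] FE[OF x1E] del: One_nat_def)
qed

theorem corollary1:
  "\<exists>c :: real \<Rightarrow> real \<Rightarrow> real \<Rightarrow> real \<Rightarrow> real \<Rightarrow> real.
    (\<forall>G \<gamma> \<eta> D \<delta>. 0 < c G \<gamma> \<eta> D \<delta>) \<and>
    (\<forall>(d :: nat) (f :: rvec \<Rightarrow> real) (h :: rvec \<Rightarrow> ereal) (G :: real) (\<gamma> :: real) (\<eta> :: real) (D :: real)
       (xmin :: rvec) (x :: nat \<Rightarrow> rvec) (g :: nat \<Rightarrow> rvec) (S :: nat \<Rightarrow> real).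
      convex_on (Rd d) f \<longrightarrow>
      G-lipschitz_on (Rd d) f \<longrightarrow>
      econvex_on (Rd d) h \<longrightarrow> proper_on (Rd d) h \<longrightarrow> lsc_on (Rd d) h \<longrightarrow>
      is_arg_min (composite f h) (\<lambda>y. y \<in> Rd d) xmin \<longrightarrow>
      0 < \<gamma> \<longrightarrow> 0 < \<eta> \<longrightarrow>
      x 1 \<in> edom (Rd d) h \<longrightarrow>
      (\<forall>k\<ge>1. g k \<in> subdifferential (Rd d) f (x k)) \<longrightarrow>
      (\<forall>k\<ge>1. is_arg_min
         (\<lambda>y. ereal (inner (g k) y + S k / (2 * \<eta>) * (norm (y - x k))\<^sup>2) + h y)
         (\<lambda>y. y \<in> Rd d) (x (k + 1))) \<longrightarrow>
      (\<forall>k\<ge>1. 0 < S k) \<longrightarrow>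
      S 1 = \<gamma> \<longrightarrow>
      (\<forall>k\<ge>1. (S (k + 1))\<^sup>2 = (S k)\<^sup>2 * (1 + (norm (x (k + 1) - x k))\<^sup>2 / \<eta>\<^sup>2)) \<longrightarrow>
      0 < D \<longrightarrow>
      (\<forall>k\<ge>1. norm (x (k + 1) - x k) \<le> D) \<longrightarrow>
      (\<forall>k\<ge>1. norm (x k - xmin) \<le> D) \<longrightarrow>
      (\<forall>t\<ge>2.
        composite f h ((1 / real t) *\<^sub>R (\<Sum>k=1..t. x (k + 1))) - composite f h xmin
          \<le> ereal (c G \<gamma> \<eta> D (real_of_ereal (composite f h (x 1) - composite f h xmin))
                   * (sqrt (ln (real t)) / sqrt (real t)))))"
\<comment> \<open>The maximum with 1 makes the constant positive for all real arguments, including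
  those outside the range of the hypotheses, where \<open>rate_const\<close> may fail to be
  positive.\<close>
proof (intro exI[of _ "\<lambda>G \<gamma> \<eta> D \<delta>. max 1 (rate_const G \<gamma> \<eta> D \<delta>)"] conjI allI impI, goal_cases)
  case (2 d f h G \<gamma> \<eta> D xmin x g S t)
  then have "composite f h ((1 / real t) *\<^sub>R (\<Sum>k=1..t. x (Suc k))) - composite f h xmin
    \<le> ereal (rate_const G \<gamma> \<eta> D (real_of_ereal (composite f h (x 1) - composite f h xmin))
              * (sqrt (ln (real t)) / sqrt (real t)))"
    by (intro adaptive_subgradient_rate[OF subspace_Rd, where d1 = d and g = g and S = S]) simp_all
  also have "\<dots> \<le> ereal (max 1 (rate_const G \<gamma> \<eta> D (real_of_ereal (composite f h (x 1) - composite f h xmin)))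
              * (sqrt (ln (real t)) / sqrt (real t)))"
    using \<open>2 \<le> t\<close> by (simp only: ereal_less_eq) (intro mult_right_mono; simp)
  finally show ?case by simp
qed simp

end
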